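(* The set $A_n=\{\langle 1,k,m\rangle: 1\le k\le m\le n-1\}$ is a minimal generating set for the semigroup $SUT_n$, and $$\mathrm{rank}(SUT_n)=|A_n|=\tfrac12 n(n-1).$$ Moreover, every $x\in SUT_n$ is a power of an element of $A_n$: $\mathbf{0}=\langle 1,1,1\rangle^2$, and $x=\langle 1,k,m+d-1\rangle^d$ for every $x=\langle d,k,m\rangle\in SUT_n\setminus\{\mathbf{0}\}$.
   Context: Fix an integer $n\ge 2$. For integers $d,k,m$ with $1-\min(0,d)\le k\le m\le n-\max(0,d)$, let $\langle d,k,m\rangle$ denote the $n\times n$ matrix with entries $x_{ij}$ ($i,j\in\{1,\dots,n\}$) equal to $1$ if $k\le i\le m$ and $j-i=d$, and $0$ otherwise. Let $\mathbf{0}$ be the $n\times n$ zero matrix and $SUT_n=\{\mathbf{0}\}\cup\{\langle d,k,m\rangle: d,k,m\in\mathbb{N},\ k\le m\le n-d\}$, a semigroup under matrix multiplication. A subset $A$ generates a finite semigroup $S$ if every element of $S$ is a finite product of elements of $A$; $A$ is a minimal generating set if no proper subset of $A$ generates $S$; and $\mathrm{rank}(S)=\min\{|A|: A\subseteq S \text{ generates } S\}$. *)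

theory Defs
  imports "Jordan_Normal_Form.Matrix"
begin

definition generates :: "('a \<Rightarrow> 'a \<Rightarrow> 'a) \<Rightarrow> 'a set \<Rightarrow> 'a set \<Rightarrow> bool" where
  "generates f S A \<longleftrightarrow>
     A \<subseteq> S \<and> (\<forall>x\<in>S. \<exists>a as. set (a # as) \<subseteq> A \<and> x = foldl f a as)"

definition minimal_generating_set :: "('a \<Rightarrow> 'a \<Rightarrow> 'a) \<Rightarrow> 'a set \<Rightarrow> 'a set \<Rightarrow> bool" where
  "minimal_generating_set f S A \<longleftrightarrow>
     generates f S A \<and> (\<forall>B. B \<subset> A \<longrightarrow> \<not> generates f S B)"

(* Intended for finite S; the finiteness of A only matters because card is 0 on infinite sets. *)
definition semigroup_rank :: "('a \<Rightarrow> 'a \<Rightarrow> 'a) \<Rightarrow> 'a set \<Rightarrow> nat" where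
  "semigroup_rank f S = (LEAST r. \<exists>A. finite A \<and> generates f S A \<and> card A = r)"

(* Matrices are indexed from 0 in the library, so row i and column j below are row i + 1 and
   column j + 1 in the usual numbering by 1, ..., n; k and m refer to the latter.
   The matrix is meant for 1 - min 0 d \<le> k, k \<le> m and m \<le> n - max 0 d. *)
definition bracket :: "nat \<Rightarrow> int \<Rightarrow> int \<Rightarrow> int \<Rightarrow> 'a::semiring_1 mat" where
  "bracket n d k m =
     mat n n (\<lambda>(i, j). if k \<le> int i + 1 \<and> int i + 1 \<le> m \<and> (int j + 1) - (int i + 1) = d
                       then 1 else 0)"

definition SUT :: "nat \<Rightarrow> 'a::semiring_1 mat set" where
  "SUT n = {0\<^sub>m n n} \<union> {bracket n d k m | d k m. 1 \<le> d \<and> 1 \<le> k \<and> k \<le> m \<and> m \<le> int n - d}"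

definition SUT_gens :: "nat \<Rightarrow> 'a::semiring_1 mat set" where
  "SUT_gens n = {bracket n 1 k m | k m. 1 \<le> k \<and> k \<le> m \<and> m \<le> int n - 1}"

lemma bracket_mult:
  assumes "0 \<le> d" "m \<le> int n - d"
  shows "bracket n d k m * bracket n d' k' m' =
    (bracket n (d + d') (max k (k' - d)) (min m (m' - d)) :: 'a::semiring_1 mat)"
    (is "?X * ?Y = ?Z")
proof (rule eq_matI)
  fix i j assume "i < dim_row ?Z" "j < dim_col ?Z"
  then have i: "i < n" and j: "j < n" by (auto simp: bracket_def)
  have "(?X * ?Y) $$ (i, j) = (\<Sum>l = 0..<n. ?X $$ (i, l) * ?Y $$ (l, j))"
    using i j by (simp add: bracket_def scalar_prod_def)
  also have "\<dots> = (\<Sum>l = 0..<n. if l = i + nat d then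
      (if k \<le> int i + 1 \<and> int i + 1 \<le> m then ?Y $$ (l, j) else 0) else 0)"
    using i assms by (intro sum.cong) (auto simp: bracket_def)
  also have "\<dots> = (if i + nat d < n then
      (if k \<le> int i + 1 \<and> int i + 1 \<le> m then ?Y $$ (i + nat d, j) else 0) else 0)"
    by (subst sum.delta) auto
  also have "\<dots> = ?Z $$ (i, j)"
    using i j assms by (auto simp: bracket_def)
  finally show "(?X * ?Y) $$ (i, j) = ?Z $$ (i, j)" .
qed (auto simp: bracket_def)

lemma bracket_empty: "m < k \<Longrightarrow> bracket n d k m = 0\<^sub>m n n"
  by (rule eq_matI) (auto simp: bracket_def)

lemma SUT_mult_closed:
  assumes "x \<in> SUT n" "y \<in> SUT n"
  shows "x * y \<in> (SUT n :: 'a::semiring_1 mat set)"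
proof -
  have [simp]: "bracket n d k m \<in> carrier_mat n n" for d k m by (simp add: bracket_def)
  have carr: "z \<in> carrier_mat n n" if "z \<in> SUT n" for z :: "'a mat"
    using that by (auto simp: SUT_def)
  show ?thesis
  proof (cases "x = 0\<^sub>m n n \<or> y = 0\<^sub>m n n")
    case True
    then show ?thesis using carr[OF assms(1)] carr[OF assms(2)] by (auto simp: SUT_def)
  next
    case False
    then obtain d k m d' k' m' where x: "x = bracket n d k m" "1 \<le> d" "1 \<le> k" "m \<le> int n - d"
      and y: "y = bracket n d' k' m'" "1 \<le> d'" "m' \<le> int n - d'"
      using assms by (auto simp: SUT_def)
    have xy: "x * y = bracket n (d + d') (max k (k' - d)) (min m (m' - d))"
      using x y by (simp add: bracket_mult)
    show ?thesis
    proof (cases "max k (k' - d) \<le> min m (m' - d)")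
      case True
      moreover have "1 \<le> d + d'" "1 \<le> max k (k' - d)" "min m (m' - d) \<le> int n - (d + d')"
        using x y by auto
      ultimately show ?thesis unfolding xy SUT_def by blast
    next
      case False
      then show ?thesis unfolding xy SUT_def by (subst bracket_empty) auto
    qed
  qed
qed

end

theory Submission
  imports Defs
begin

text \<open>
  A product of two strictly upper triangular matrices vanishes on the first superdiagonal, whereas
  every element of \<^term>\<open>SUT_gens n\<close> has an entry 1 there. So these elements are indecomposable
  in \<^term>\<open>SUT n\<close> and lie in every generating set. Conversely,
  \<open>\<langle>1, k, m\<rangle>\<^sup>p = \<langle>p, k, m - p + 1\<rangle>\<close>, which is zero once \<open>p\<close> exceeds \<open>m - k + 1\<close>, so that their
  powers exhaust \<^term>\<open>SUT n\<close>. A generating set contained in every other one is minimal and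
  attains the rank.
\<close>

definition indecomposables :: "('a \<Rightarrow> 'a \<Rightarrow> 'a) \<Rightarrow> 'a set \<Rightarrow> 'a set" where
  "indecomposables f S = {a \<in> S. \<forall>x\<in>S. \<forall>y\<in>S. f x y \<noteq> a}"

lemma foldl_closed:
  assumes closed: "\<And>x y. x \<in> S \<Longrightarrow> y \<in> S \<Longrightarrow> f x y \<in> S"
    and "a \<in> S" "set as \<subseteq> S"
  shows "foldl f a as \<in> S"
  using assms(2,3) by (induction as arbitrary: a) (auto intro: closed)

lemma indecomposables_subset_generating:
  assumes closed: "\<And>x y. x \<in> S \<Longrightarrow> y \<in> S \<Longrightarrow> f x y \<in> S"
    and gen: "generates f S B"
  shows "indecomposables f S \<subseteq> B"
proof
  fix a assume a: "a \<in> indecomposables f S"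
  then obtain b bs where bs: "set (b # bs) \<subseteq> B" "a = foldl f b bs"
    using gen unfolding generates_def indecomposables_def by blast
  then have in_S: "set (b # bs) \<subseteq> S"
    using gen unfolding generates_def by blast
  show "a \<in> B"
  proof (cases bs rule: rev_cases)
    case Nil
    then show ?thesis using bs by simp
  next
    case (snoc cs c)
    then have "a = f (foldl f b cs) c" using bs(2) by simp
    moreover have "foldl f b cs \<in> S" "c \<in> S"
      using in_S snoc by (auto intro: foldl_closed closed)
    ultimately show ?thesis using a unfolding indecomposables_def by blast
  qed
qed

lemma minimal_generating_set_least:
  assumes "generates f S A" "\<And>B. generates f S B \<Longrightarrow> A \<subseteq> B"
  shows "minimal_generating_set f S A"
  using assms unfolding minimal_generating_set_def by blast

lemma semigroup_rank_least:
  assumes "generates f S A" "finite A" "\<And>B. generates f S B \<Longrightarrow> A \<subseteq> B"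
  shows "semigroup_rank f S = card A"
  unfolding semigroup_rank_def
proof (rule Least_equality)
  show "\<exists>B. finite B \<and> generates f S B \<and> card B = card A"
    using assms(1,2) by blast
  show "card A \<le> r" if "\<exists>B. finite B \<and> generates f S B \<and> card B = r" for r
    using that assms(3) card_mono by blast
qed

lemma pow_mat_Suc_eq_foldl:
  assumes "a \<in> carrier_mat n n"
  shows "a ^\<^sub>m Suc p = foldl (*) a (replicate p a)"
proof (induction p)
  case 0
  then show ?case using assms by simp
next
  case (Suc p)
  have "foldl (*) a (replicate (Suc p) a) = foldl (*) a (replicate p a) * a"
    by (simp flip: replicate_append_same)
  then show ?case using Suc by simp
qed

lemma generates_if_all_pow_mat:
  assumes "A \<subseteq> S" "A \<subseteq> carrier_mat n n"
    and pow: "\<And>x. x \<in> S \<Longrightarrow> \<exists>a\<in>A. \<exists>p\<ge>1. x = a ^\<^sub>m p"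
  shows "generates (*) S A"
  unfolding generates_def
proof (intro conjI ballI assms(1))
  fix x assume "x \<in> S"
  then obtain a p where a: "a \<in> A" and "p \<ge> 1" "x = a ^\<^sub>m p"
    using pow by blast
  then obtain q where "x = a ^\<^sub>m Suc q"
    by (cases p) auto
  also have "\<dots> = foldl (*) a (replicate q a)"
    using a assms(2) by (intro pow_mat_Suc_eq_foldl) blast
  finally show "\<exists>a as. set (a # as) \<subseteq> A \<and> x = foldl (*) a as"
    using a by (intro exI[of _ a] exI[of _ "replicate q a"]) auto
qed

definition strictly_upper_triangular :: "'a::zero mat \<Rightarrow> bool" where
  "strictly_upper_triangular A \<longleftrightarrow> (\<forall>i < dim_row A. \<forall>j \<le> i. A $$ (i, j) = 0)"

lemma strictly_upper_triangular_mult_superdiag: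
  fixes A B :: "'a::semiring_0 mat"
  assumes carrier: "A \<in> carrier_mat n n" "B \<in> carrier_mat n n"
    and "strictly_upper_triangular A" "strictly_upper_triangular B"
    and i: "Suc i < n"
  shows "(A * B) $$ (i, Suc i) = 0"
proof -
  have "A $$ (i, l) * B $$ (l, Suc i) = 0" if "l < n" for l
    using assms that unfolding strictly_upper_triangular_def by (cases "l \<le> i") auto
  then show ?thesis
    using carrier i by (simp add: scalar_prod_def)
qed

lemma bracket_carrier [simp]: "bracket n d k m \<in> carrier_mat n n"
  by (simp add: bracket_def)

lemma bracket_index:
  assumes "i < n" "j < n"
  shows "bracket n d k m $$ (i, j) =
    (if k \<le> int i + 1 \<and> int i + 1 \<le> m \<and> int j - int i = d then 1 else 0)"
  using assms by (simp add: bracket_def)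

lemma strictly_upper_triangular_bracket:
  assumes "1 \<le> d"
  shows "strictly_upper_triangular (bracket n d k m)"
  using assms by (auto simp: strictly_upper_triangular_def bracket_def)

lemma bracket_eqD:
  assumes eq: "bracket n d k m = (bracket n d' k' m' :: 'a::semiring_1 mat)"
    and r: "k \<le> r" "r \<le> m" "1 - min 0 d \<le> r" "r \<le> int n - max 0 d"
  shows "d = d'" "k' \<le> r" "r \<le> m'"
proof -
  define i j where "i = nat (r - 1)" and "j = nat (r + d - 1)"
  have ij: "int i + 1 = r" "int j - int i = d" "i < n" "j < n"
    using r by (auto simp: i_def j_def)
  have "(bracket n d' k' m' :: 'a mat) $$ (i, j) = bracket n d k m $$ (i, j)"
    by (simp only: eq)
  also have "\<dots> = 1" using ij r by (simp add: bracket_index)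
  finally show "d = d'" "k' \<le> r" "r \<le> m'"
    using ij by (auto simp: bracket_index split: if_splits)
qed

lemma bracket_inject:
  assumes eq: "bracket n d k m = (bracket n d' k' m' :: 'a::semiring_1 mat)"
    and km: "1 - min 0 d \<le> k" "k \<le> m" "m \<le> int n - max 0 d"
    and km': "1 - min 0 d' \<le> k'" "k' \<le> m'" "m' \<le> int n - max 0 d'"
  shows "d = d' \<and> k = k' \<and> m = m'"
proof -
  have "d = d'" "k' \<le> k" "m \<le> m'"
    using bracket_eqD[OF eq, of k] bracket_eqD[OF eq, of m] km by auto
  moreover have "k \<le> k'" "m' \<le> m"
    using bracket_eqD[OF eq[symmetric], of k'] bracket_eqD[OF eq[symmetric], of m'] km' by auto
  ultimately show ?thesis by simp
qed

lemma bracket_pow: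
  assumes "p \<ge> 1" "0 \<le> d" "m \<le> int n - d"
  shows "bracket n d k m ^\<^sub>m p =
    (bracket n (int p * d) k (m - (int p - 1) * d) :: 'a::semiring_1 mat)"
  using \<open>p \<ge> 1\<close>
proof (induction p rule: nat_induct_at_least)
  case base
  then show ?case using left_mult_one_mat[OF bracket_carrier] by (simp add: bracket_def)
next
  case (Suc p)
  have pd: "0 \<le> int p * d" using \<open>0 \<le> d\<close> by simp
  have "bracket n d k m ^\<^sub>m Suc p =
      bracket n (int p * d) k (m - (int p - 1) * d) * (bracket n d k m :: 'a mat)"
    by (simp only: pow_mat.simps Suc.IH)
  also have "\<dots> = bracket n (int p * d + d) (max k (k - int p * d))
      (min (m - (int p - 1) * d) (m - int p * d))"
    using pd assms(3) by (intro bracket_mult) (simp_all add: algebra_simps)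
  also have "\<dots> = bracket n (int (Suc p) * d) k (m - (int (Suc p) - 1) * d)"
  proof -
    have "max k (k - int p * d) = k" using pd by simp
    moreover have "min (m - (int p - 1) * d) (m - int p * d) = m - int p * d"
      using \<open>0 \<le> d\<close> by (simp add: left_diff_distrib)
    ultimately show ?thesis by (simp add: algebra_simps)
  qed
  finally show ?case .
qed

lemma bracket_eq_bracket_1_pow:
  assumes "1 \<le> d" "m \<le> int n - d"
  shows "bracket n d k m = (bracket n 1 k (m + d - 1) ^\<^sub>m nat d :: 'a::semiring_1 mat)"
  using assms by (simp add: bracket_pow)

lemma zero_eq_bracket_1_square:
  assumes "k \<le> int n - 1"
  shows "(0\<^sub>m n n :: 'a::semiring_1 mat) = bracket n 1 k k ^\<^sub>m 2"
  using assms by (simp add: bracket_pow bracket_empty)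

lemma SUT_cases [consumes 1, case_names zero bracket]:
  assumes "x \<in> SUT n"
  obtains "x = 0\<^sub>m n n"
  | d k m where "x = bracket n d k m" "1 \<le> d" "1 \<le> k" "k \<le> m" "m \<le> int n - d"
  using assms unfolding SUT_def by blast

lemma bracket_in_SUT_gens:
  assumes "1 \<le> k" "k \<le> m" "m \<le> int n - 1"
  shows "bracket n 1 k m \<in> SUT_gens n"
  using assms unfolding SUT_gens_def by blast

lemma SUT_gens_subset_SUT: "SUT_gens n \<subseteq> SUT n"
  unfolding SUT_gens_def SUT_def by force

lemma SUT_subset_carrier: "SUT n \<subseteq> carrier_mat n n"
  by (auto elim: SUT_cases)

lemma SUT_strictly_upper_triangular:
  assumes "x \<in> SUT n"
  shows "strictly_upper_triangular x"
  using assms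
proof (cases rule: SUT_cases)
  case zero
  then show ?thesis by (simp add: strictly_upper_triangular_def)
next
  case bracket
  then show ?thesis by (simp add: strictly_upper_triangular_bracket)
qed

lemma SUT_gens_superdiag_one:
  assumes "a \<in> (SUT_gens n :: 'a::semiring_1 mat set)"
  obtains i where "Suc i < n" "a $$ (i, Suc i) = 1"
proof -
  obtain k m where "a = bracket n 1 k m" "1 \<le> k" "k \<le> m" "m \<le> int n - 1"
    using assms unfolding SUT_gens_def by blast
  then show ?thesis by (intro that[of "nat (k - 1)"]) (simp_all add: bracket_index)
qed

lemma SUT_gens_subset_indecomposables:
  "SUT_gens n \<subseteq> indecomposables (*) (SUT n :: 'a::semiring_1 mat set)"
proof
  fix a :: "'a mat" assume a: "a \<in> SUT_gens n"
  then obtain i where i: "Suc i < n" "a $$ (i, Suc i) = 1"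
    by (rule SUT_gens_superdiag_one)
  have "x * y \<noteq> a" if "x \<in> SUT n" "y \<in> SUT n" for x y
  proof -
    have "(x * y) $$ (i, Suc i) = 0"
      using that SUT_subset_carrier i
      by (blast intro: strictly_upper_triangular_mult_superdiag SUT_strictly_upper_triangular)
    then show ?thesis using i by auto
  qed
  then show "a \<in> indecomposables (*) (SUT n)"
    using a SUT_gens_subset_SUT unfolding indecomposables_def by blast
qed

lemma SUT_gens_subset_generating:
  assumes "generates (*) (SUT n) B"
  shows "SUT_gens n \<subseteq> (B :: 'a::semiring_1 mat set)"
  using SUT_gens_subset_indecomposables indecomposables_subset_generating[OF SUT_mult_closed assms]
  by (rule subset_trans)

lemma SUT_eq_pow_SUT_gens:
  assumes "n \<ge> 2" "x \<in> (SUT n :: 'a::semiring_1 mat set)"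
  shows "\<exists>a \<in> SUT_gens n. \<exists>p \<ge> 1. x = a ^\<^sub>m p"
  using assms(2)
proof (cases rule: SUT_cases)
  case zero
  then have "x = bracket n 1 1 1 ^\<^sub>m 2"
    using zero_eq_bracket_1_square[of 1 n] assms(1) by simp
  moreover have "bracket n 1 1 1 \<in> (SUT_gens n :: 'a mat set)"
    using assms(1) by (simp add: bracket_in_SUT_gens)
  ultimately show ?thesis using one_le_numeral by blast
next
  case (bracket d k m)
  then have "x = bracket n 1 k (m + d - 1) ^\<^sub>m nat d"
    using bracket_eq_bracket_1_pow by blast
  moreover have "bracket n 1 k (m + d - 1) \<in> (SUT_gens n :: 'a mat set)"
    using bracket by (simp add: bracket_in_SUT_gens)
  moreover have "1 \<le> nat d" using bracket by linarith
  ultimately show ?thesis by blast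
qed

lemma generates_SUT_gens:
  assumes "n \<ge> 2"
  shows "generates (*) (SUT n) (SUT_gens n :: 'a::semiring_1 mat set)"
  using SUT_gens_subset_SUT SUT_subset_carrier SUT_eq_pow_SUT_gens[OF assms]
  by (intro generates_if_all_pow_mat) blast+

lemma SUT_gens_eq_image:
  "SUT_gens n = (\<lambda>(m, k). bracket n 1 k m) ` (SIGMA m:{1..int n - 1}. {1..m})"
  unfolding SUT_gens_def by force

lemma finite_SUT_gens: "finite (SUT_gens n)"
  by (simp add: SUT_gens_eq_image)

lemma card_SUT_gens: "card (SUT_gens n :: 'a::semiring_1 mat set) = n choose 2"
proof -
  have "inj_on (\<lambda>(m, k). bracket n 1 k m :: 'a mat) (SIGMA m:{1..int n - 1}. {1..m})"
    by (rule inj_onI) (auto dest!: bracket_inject)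
  then have "card (SUT_gens n :: 'a mat set) = card (SIGMA m:{1..int n - 1}. {1..m})"
    by (simp add: SUT_gens_eq_image card_image)
  also have "\<dots> = (\<Sum>m = 1..int n - 1. nat m)"
    by simp
  also have "\<dots> = \<Sum>{1..<n}"
    by (rule sum.reindex_bij_witness[of _ int nat]) auto
  also have "\<dots> = n choose 2"
    by (simp add: Sum_Ico_nat choose_two)
  finally show ?thesis .
qed

theorem theorem15:
  fixes n :: nat
  assumes "n \<ge> 2"
  shows "minimal_generating_set (*) (SUT n) (SUT_gens n :: 'a::semiring_1 mat set) \<and>
    semigroup_rank (*) (SUT n :: 'a mat set) = card (SUT_gens n :: 'a mat set) \<and>
    real (card (SUT_gens n :: 'a mat set)) = 1 / 2 * real n * (real n - 1) \<and>
    (\<forall>x \<in> (SUT n :: 'a mat set). \<exists>a \<in> SUT_gens n. \<exists>p \<ge> 1. x = a ^\<^sub>m p) \<and>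
    bracket n 1 1 1 \<in> (SUT_gens n :: 'a mat set) \<and>
    (0\<^sub>m n n :: 'a mat) = bracket n 1 1 1 ^\<^sub>m 2 \<and>
    (\<forall>x \<in> SUT n - {0\<^sub>m n n :: 'a mat}. \<forall>d k m.
       1 \<le> d \<and> 1 \<le> k \<and> k \<le> m \<and> m \<le> int n - d \<and> x = bracket n d k m \<longrightarrow>
         bracket n 1 k (m + d - 1) \<in> (SUT_gens n :: 'a mat set) \<and>
         x = bracket n 1 k (m + d - 1) ^\<^sub>m nat d)"
proof (intro conjI ballI allI impI)
  note gen = generates_SUT_gens[OF assms]
  show "minimal_generating_set (*) (SUT n) (SUT_gens n :: 'a mat set)"
    using gen SUT_gens_subset_generating by (rule minimal_generating_set_least)
  show "semigroup_rank (*) (SUT n :: 'a mat set) = card (SUT_gens n :: 'a mat set)"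
    using gen finite_SUT_gens SUT_gens_subset_generating by (rule semigroup_rank_least)
  show "real (card (SUT_gens n :: 'a mat set)) = 1 / 2 * real n * (real n - 1)"
    using assms by (simp add: card_SUT_gens choose_two real_of_nat_div of_nat_diff)
  show "\<exists>a \<in> SUT_gens n. \<exists>p \<ge> 1. x = a ^\<^sub>m p" if "x \<in> SUT n" for x :: "'a mat"
    using assms that by (rule SUT_eq_pow_SUT_gens)
  show "bracket n 1 1 1 \<in> (SUT_gens n :: 'a mat set)"
    using assms by (simp add: bracket_in_SUT_gens)
  show "(0\<^sub>m n n :: 'a mat) = bracket n 1 1 1 ^\<^sub>m 2"
    using assms by (intro zero_eq_bracket_1_square) simp
  fix x :: "'a mat" and d k m
  assume dkm: "1 \<le> d \<and> 1 \<le> k \<and> k \<le> m \<and> m \<le> int n - d \<and> x = bracket n d k m"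
  show "bracket n 1 k (m + d - 1) \<in> (SUT_gens n :: 'a mat set)"
    using dkm by (simp add: bracket_in_SUT_gens)
  show "x = bracket n 1 k (m + d - 1) ^\<^sub>m nat d"
    using dkm bracket_eq_bracket_1_pow by blast
qed

end
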